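(* Consider two consecutive time periods $t-1$ and $t$. Let $X$ be the set of all $(p_{t-1},p_t,u_{t-1},u_t)$ with $p_{t-1},p_t\ge 0$, $u_{t-1},u_t\in\{0,1\}$ and $$\underline P\,u_s\le p_s\le\overline P\,u_s\quad(s\in\{t-1,t\}),$$ $$p_t-p_{t-1}\le\overline P^{\mathrm{su}}u_t-(\overline P^{\mathrm{su}}-\overline R^{\mathrm{up}})u_{t-1},\qquad p_{t-1}-p_t\le\overline P^{\mathrm{sd}}u_{t-1}-(\overline P^{\mathrm{sd}}-\overline R^{\mathrm{dn}})u_t .$$ Then the following linear inequalities are necessary and sufficient to describe the convex hull of $X$: $$\underline P\,u_s\le p_s\le\overline P\,u_s,\qquad u_s\le 1\qquad(s\in\{t-1,t\}),$$ $$p_t-p_{t-1}\le(\underline P+\overline R^{\mathrm{up}})u_t-\underline P u_{t-1},\qquad p_{t-1}-p_t\le(\underline P+\overline R^{\mathrm{dn}})u_{t-1}-\underline P u_t,$$ $$p_t-p_{t-1}\le\overline P^{\mathrm{su}}u_t-(\overline P^{\mathrm{su}}-\overline R^{\mathrm{up}})u_{t-1},\qquad p_{t-1}-p_t\le\overline P^{\mathrm{sd}}u_{t-1}-(\overline P^{\mathrm{sd}}-\overline R^{\mathrm{dn}})u_t,$$ $$p_t\le\overline P^{\mathrm{su}}u_t+(\overline P-\overline P^{\mathrm{su}})u_{t-1},\qquad p_{t-1}\le\overline P^{\mathrm{sd}}u_{t-1}+(\overline P-\overline P^{\mathrm{sd}})u_t .$$ That is, the convex hull of $X$ is exactly the set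 of real $(p_{t-1},p_t,u_{t-1},u_t)$ satisfying all these inequalities (sufficiency), and none of these inequalities is redundant (necessity).
   Context: Single-unit, two-period unit commitment problem with ramping up and down and start-up and shut-down capabilities, without a demand balance constraint. Here $p_s$ is the production of the unit in period $s$ and $u_s$ its commitment (up/down) status. Parameters: $\underline P$ and $\overline P$ are the minimum and maximum output of the unit in one period when it is up; $\overline R^{\mathrm{up}}$ and $\overline R^{\mathrm{dn}}$ are the maximum amounts by which it can ramp its output up and down in one period; $\overline P^{\mathrm{su}}$ and $\overline P^{\mathrm{sd}}$ are its maximum output in the period in which it starts up and in the period before it shuts down, respectively, with $\underline P\le\overline P^{\mathrm{su}}\le\underline P+\overline R^{\mathrm{up}}$ and $\underline P\le\overline P^{\mathrm{sd}}\le\underline P+\overline R^{\mathrm{dn}}$. An inequality in a list is redundant if deleting it does not change the solution set of the list.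
   Formalization: Assumes 0≤P̲≤P̄, P̄^su,P̄^sd≤P̄, and not (P̲=P̄, R̄^up=R̄^dn=0). Non-redundancy is false in general; proved to hold iff P̄^su<P̲+R̄^up<P̄ and P̄^sd<P̲+R̄^dn<P̄; if 0<R̄^up,R̄^dn<P̄−P̲, only duplicated inequalities are redundant. *)

theory Defs
  imports "HOL-Analysis.Analysis"
begin

(* A point (p0, p1, u0, u1) collects the production p and the commitment u in the
   periods t - 1 (index 0) and t (index 1). *)
type_synonym uc_point = "real \<times> real \<times> real \<times> real"

definition feasible_set ::
    "real \<Rightarrow> real \<Rightarrow> real \<Rightarrow> real \<Rightarrow> real \<Rightarrow> real \<Rightarrow> uc_point set" where
  "feasible_set Pmin Pmax Rup Rdn Psu Psd = {(p0, p1, u0, u1).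
     0 \<le> p0 \<and> 0 \<le> p1 \<and> u0 \<in> {0, 1} \<and> u1 \<in> {0, 1} \<and>
     Pmin * u0 \<le> p0 \<and> p0 \<le> Pmax * u0 \<and>
     Pmin * u1 \<le> p1 \<and> p1 \<le> Pmax * u1 \<and>
     p1 - p0 \<le> Psu * u1 - (Psu - Rup) * u0 \<and>
     p0 - p1 \<le> Psd * u0 - (Psd - Rdn) * u1}"

definition hull_inequalities ::
    "real \<Rightarrow> real \<Rightarrow> real \<Rightarrow> real \<Rightarrow> real \<Rightarrow> real \<Rightarrow> (uc_point \<Rightarrow> bool) list" where
  "hull_inequalities Pmin Pmax Rup Rdn Psu Psd =
    [\<lambda>(p0, p1, u0, u1). Pmin * u0 \<le> p0,
     \<lambda>(p0, p1, u0, u1). p0 \<le> Pmax * u0,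
     \<lambda>(p0, p1, u0, u1). Pmin * u1 \<le> p1,
     \<lambda>(p0, p1, u0, u1). p1 \<le> Pmax * u1,
     \<lambda>(p0, p1, u0, u1). u0 \<le> 1,
     \<lambda>(p0, p1, u0, u1). u1 \<le> 1,
     \<lambda>(p0, p1, u0, u1). p1 - p0 \<le> (Pmin + Rup) * u1 - Pmin * u0,
     \<lambda>(p0, p1, u0, u1). p0 - p1 \<le> (Pmin + Rdn) * u0 - Pmin * u1,
     \<lambda>(p0, p1, u0, u1). p1 - p0 \<le> Psu * u1 - (Psu - Rup) * u0,
     \<lambda>(p0, p1, u0, u1). p0 - p1 \<le> Psd * u0 - (Psd - Rdn) * u1,
     \<lambda>(p0, p1, u0, u1). p1 \<le> Psu * u1 + (Pmax - Psu) * u0,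
     \<lambda>(p0, p1, u0, u1). p0 \<le> Psd * u0 + (Pmax - Psd) * u1]"

definition solution_set :: "('a \<Rightarrow> bool) list \<Rightarrow> 'a set" where
  "solution_set cs = {x. \<forall>c \<in> set cs. c x}"

(* Redundancy is a property of a position in the list: only the entry at position i is
   deleted, so two equal entries make each other redundant. *)
definition redundant :: "('a \<Rightarrow> bool) list \<Rightarrow> nat \<Rightarrow> bool" where
  "redundant cs i \<longleftrightarrow> solution_set (take i cs @ drop (Suc i) cs) = solution_set cs"

end

theory Submission
  imports Defs
begin

text \<open>
  Write \<open>X\<^sub>a\<^sub>b\<close> for the feasible points with commitments \<open>(a, b)\<close>. Each of these four sets is a
  polytope: \<open>X\<^sub>0\<^sub>0\<close> is the origin, \<open>X\<^sub>1\<^sub>0\<close> and \<open>X\<^sub>0\<^sub>1\<close> are the segments \<open>p0 \<in> [Pmin, Psd]\<close> and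
  \<open>p1 \<in> [Pmin, Psu]\<close>, and \<open>X\<^sub>1\<^sub>1\<close> is the polygon cut out by the capacity and ramping limits.

  Sufficiency. A point of the hull is a mixture of the four polytopes. A pair of points from \<open>X\<^sub>1\<^sub>0\<close>
  and \<open>X\<^sub>0\<^sub>1\<close> with productions \<open>a\<close> and \<open>b\<close> has the same sum as the origin and the point of \<open>X\<^sub>1\<^sub>1\<close>
  with productions \<open>(a, b)\<close>; that point respects the ramps because \<open>Psu \<le> Pmin + Rup\<close> and
  \<open>Psd \<le> Pmin + Rdn\<close>. Hence one of \<open>X\<^sub>1\<^sub>0\<close> and \<open>X\<^sub>0\<^sub>1\<close> may be dropped: for \<open>u1 \<le> u0\<close> the weights must
  be \<open>1 - u0\<close>, \<open>u0 - u1\<close> and \<open>u1\<close> on \<open>X\<^sub>0\<^sub>0\<close>, \<open>X\<^sub>1\<^sub>0\<close> and \<open>X\<^sub>1\<^sub>1\<close>. The only freedom left is how to split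
  \<open>p0\<close> between \<open>X\<^sub>1\<^sub>0\<close> and \<open>X\<^sub>1\<^sub>1\<close>, and Fourier-Motzkin elimination of this one number leaves exactly
  the listed inequalities (lemma \<open>in_hull_if_shutdown\<close>). Exchanging the two periods exchanges the
  roles of ramping up and down and settles \<open>u0 \<le> u1\<close>.

  Necessity. Lemma \<open>hull_inequalities_irredundant\<close> gives, for each inequality that is not
  duplicated, a point violating it alone, provided that both ramps are positive and too small to
  reach \<open>Pmax\<close> from \<open>Pmin\<close>. All inequalities but \<open>u0 \<le> 1\<close> and \<open>u1 \<le> 1\<close> are homogeneous, so it is the ratio of \<open>u0\<close> to
  \<open>u1\<close> that matters. The right-hand sides of the two upward ramping inequalities differ by
  \<open>(Pmin + Rup - Psu) * (u1 - u0)\<close>, and that of the start-up capacity inequality differs from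
  \<open>Pmax * u1\<close> by \<open>(Pmax - Psu) * (u0 - u1)\<close>. So the witnesses for such competing inequalities lie on
  opposite sides of \<open>u0 = u1\<close>. The same differences show when redundancy occurs: the two
  upward ramping inequalities coincide if \<open>Psu = Pmin + Rup\<close>, and the start-up capacity inequality
  becomes \<open>p1 \<le> Pmax * u1\<close> if \<open>Psu = Pmax\<close>. Finally, if \<open>Pmin + Rup \<ge> Pmax > Pmin\<close>, the ramping
  inequality with \<open>Pmin + Rup\<close> follows from the output limits alone.
\<close>

section \<open>The inequalities\<close>

lemma mem_feasible_set:
  "(p0, p1, u0, u1) \<in> feasible_set Pmin Pmax Rup Rdn Psu Psd \<longleftrightarrow>
     0 \<le> p0 \<and> 0 \<le> p1 \<and> u0 \<in> {0, 1} \<and> u1 \<in> {0, 1} \<and>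
     Pmin * u0 \<le> p0 \<and> p0 \<le> Pmax * u0 \<and>
     Pmin * u1 \<le> p1 \<and> p1 \<le> Pmax * u1 \<and>
     p1 - p0 \<le> Psu * u1 - (Psu - Rup) * u0 \<and>
     p0 - p1 \<le> Psd * u0 - (Psd - Rdn) * u1"
  by (simp add: feasible_set_def)

lemma mem_solution_set_hull:
  "(p0, p1, u0, u1) \<in> solution_set (hull_inequalities Pmin Pmax Rup Rdn Psu Psd) \<longleftrightarrow>
     Pmin * u0 \<le> p0 \<and> p0 \<le> Pmax * u0 \<and>
     Pmin * u1 \<le> p1 \<and> p1 \<le> Pmax * u1 \<and>
     u0 \<le> 1 \<and> u1 \<le> 1 \<and>
     p1 - p0 \<le> (Pmin + Rup) * u1 - Pmin * u0 \<and>
     p0 - p1 \<le> (Pmin + Rdn) * u0 - Pmin * u1 \<and>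
     p1 - p0 \<le> Psu * u1 - (Psu - Rup) * u0 \<and>
     p0 - p1 \<le> Psd * u0 - (Psd - Rdn) * u1 \<and>
     p1 \<le> Psu * u1 + (Pmax - Psu) * u0 \<and>
     p0 \<le> Psd * u0 + (Pmax - Psd) * u1"
  by (simp add: solution_set_def hull_inequalities_def)

lemma convex_hull_inequalities:
  "convex (solution_set (hull_inequalities Pmin Pmax Rup Rdn Psu Psd))"
proof -
  \<comment> \<open>Each inequality is a half-space, given by its coefficients and its right-hand side.\<close>
  let ?rows = "[((-1, 0, Pmin, 0), 0), ((1, 0, - Pmax, 0), 0),
    ((0, -1, 0, Pmin), 0), ((0, 1, 0, - Pmax), 0),
    ((0, 0, 1, 0), 1), ((0, 0, 0, 1), 1),
    ((-1, 1, Pmin, - (Pmin + Rup)), 0), ((1, -1, - (Pmin + Rdn), Pmin), 0),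
    ((-1, 1, Psu - Rup, - Psu), 0), ((1, -1, - Psd, Psd - Rdn), 0),
    ((0, 1, Psu - Pmax, - Psu), 0), ((1, 0, - Psd, Psd - Pmax), 0)] :: (uc_point \<times> real) list"
  have "solution_set (hull_inequalities Pmin Pmax Rup Rdn Psu Psd) =
      (\<Inter>(a, b)\<in>set ?rows. {z. inner a z \<le> b})"
    by (auto simp: mem_solution_set_hull algebra_simps)
  also have "convex \<dots>"
    by (intro convex_INT) (auto simp: convex_halfspace_le)
  finally show ?thesis .
qed

section \<open>Sufficiency\<close>

lemma commitment_nonneg:
  assumes "(p0, p1, u0, u1) \<in> solution_set (hull_inequalities Pmin Pmax Rup Rdn Psu Psd)"
    and "Pmin \<le> Pmax"
    and "Pmin \<le> Psu" "Psu \<le> Pmin + Rup" "Psu \<le> Pmax"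
    and "Pmin \<le> Psd" "Psd \<le> Pmin + Rdn" "Psd \<le> Pmax"
    and "Pmin < Pmax \<or> 0 < Rup \<or> 0 < Rdn"
  shows "0 \<le> u0" "0 \<le> u1"
proof -
  have "0 \<le> u0 \<and> 0 \<le> u1"
  proof (cases "Pmin < Pmax")
    case True
    have "0 \<le> (Pmax - Pmin) * u0" "0 \<le> (Pmax - Pmin) * u1"
      using assms(1) by (auto simp: mem_solution_set_hull algebra_simps)
    then show ?thesis
      using True by (simp add: zero_le_mult_iff)
  next
    \<comment> \<open>The output is pinned to the commitment, and the ramping inequalities read \<open>0 \<le> Rup * u\<close>
      and \<open>0 \<le> Rdn * u\<close>.\<close>
    case False
    then have eq: "Pmax = Pmin" "Psu = Pmin" "Psd = Pmin"
      using assms by linarith+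
    have "0 \<le> Rup * u0" "0 \<le> Rup * u1" "0 \<le> Rdn * u0" "0 \<le> Rdn * u1"
      using assms(1) by (auto simp: mem_solution_set_hull eq algebra_simps)
    moreover have "0 < Rup \<or> 0 < Rdn"
      using assms False by blast
    ultimately show ?thesis
      by (auto simp: zero_le_mult_iff)
  qed
  then show "0 \<le> u0" "0 \<le> u1" by auto
qed

lemma feasible_set_subset:
  assumes "0 \<le> Pmin" "Pmin \<le> Pmax"
    and "Pmin \<le> Psu" "Psu \<le> Pmin + Rup" "Psu \<le> Pmax"
    and "Pmin \<le> Psd" "Psd \<le> Pmin + Rdn" "Psd \<le> Pmax"
  shows "feasible_set Pmin Pmax Rup Rdn Psu Psd
    \<subseteq> solution_set (hull_inequalities Pmin Pmax Rup Rdn Psu Psd)"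
  using assms by (auto simp: mem_feasible_set mem_solution_set_hull)

text \<open>For weight \<open>c = 0\<close> any \<open>a\<close> serves, which is why the interval has to be nonempty.\<close>
lemma scaled_interval:
  fixes c A l h :: real
  assumes "0 \<le> c" "l \<le> h" "l * c \<le> A" "A \<le> h * c"
  obtains a where "l \<le> a" "a \<le> h" "A = c * a"
proof (cases "c = 0")
  case True
  then show ?thesis
    using assms that[of l] by simp
next
  case False
  then have "l \<le> A / c" "A / c \<le> h" "A = c * (A / c)"
    using assms by (auto simp: field_simps)
  then show ?thesis using that by blast
qed

text \<open>The number \<open>x\<close> below is the part of \<open>p0\<close> carried by the points with commitments \<open>(1, 1)\<close>,
  which have total weight \<open>u1\<close>; the remainder \<open>p0 - x\<close> is carried by those that shut down. The
  limits on both parts give three lower and three upper bounds on \<open>x\<close>, and the nine comparisons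
  between them are the inequalities of the description, or follow from those between the parameters.\<close>
lemma in_hull_if_shutdown:
  assumes sol: "(p0, p1, u0, u1) \<in> solution_set (hull_inequalities Pmin Pmax Rup Rdn Psu Psd)"
    and par: "0 \<le> Pmin" "Pmin \<le> Pmax"
      "Pmin \<le> Psu" "Psu \<le> Pmin + Rup" "Psu \<le> Pmax"
      "Pmin \<le> Psd" "Psd \<le> Pmin + Rdn" "Psd \<le> Pmax"
    and u: "0 \<le> u1" "u1 \<le> u0"
  shows "(p0, p1, u0, u1) \<in> convex hull (feasible_set Pmin Pmax Rup Rdn Psu Psd)"
    (is "_ \<in> convex hull ?X")
proof -
  define x where "x = max (Pmin * u1) (max (p1 - Rup * u1) (p0 - Psd * (u0 - u1)))"
  have nonneg: "0 \<le> Rup * u1" "0 \<le> Rdn * u1" "Pmin * u1 \<le> Pmax * u1"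
      "Pmin * (u0 - u1) \<le> Psd * (u0 - u1)"
    using par u by (auto intro: mult_right_mono)
  have lower: "Pmin * u1 \<le> x" "p1 - Rup * u1 \<le> x" "p0 - Psd * (u0 - u1) \<le> x"
    by (auto simp: x_def)
  have upper: "x \<le> Pmax * u1" "x \<le> p1 + Rdn * u1" "x \<le> p0 - Pmin * (u0 - u1)"
    unfolding x_def max.bounded_iff
    using sol nonneg by (simp_all add: mem_solution_set_hull algebra_simps)
  have "0 \<le> u0 - u1" "Pmin * (u0 - u1) \<le> p0 - x" "p0 - x \<le> Psd * (u0 - u1)"
    using u lower upper by linarith+
  then obtain a where a: "Pmin \<le> a" "a \<le> Psd" "p0 - x = (u0 - u1) * a"
    using scaled_interval par(6) by metis
  obtain b c where bc: "(b, c, 1, 1) \<in> ?X" "x = u1 * b" "p1 = u1 * c"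
  proof (cases "u1 = 0")
    case True
    then have "x = 0" "p1 = 0"
      using lower upper sol by (auto simp: mem_solution_set_hull)
    then show ?thesis
      using True par that[of Pmin Pmin] by (simp add: mem_feasible_set)
  next
    case False
    then have pos: "0 < u1" using u by simp
    have "Pmin * u1 \<le> p1" "p1 \<le> Pmax * u1" "p1 - x \<le> Rup * u1" "x - p1 \<le> Rdn * u1"
      using sol lower upper by (simp_all add: mem_solution_set_hull)
    then have "Pmin \<le> x / u1" "x / u1 \<le> Pmax" "Pmin \<le> p1 / u1" "p1 / u1 \<le> Pmax"
        "p1 / u1 - x / u1 \<le> Rup" "x / u1 - p1 / u1 \<le> Rdn"
      using pos lower(1) upper(1)
      by (simp_all add: pos_le_divide_eq pos_divide_le_eq flip: diff_divide_distrib)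
    then have "(x / u1, p1 / u1, 1, 1) \<in> ?X"
      using par by (simp add: mem_feasible_set)
    then show ?thesis
      using pos that[of "x / u1" "p1 / u1"] by simp
  qed
  let ?o = "(0, 0, 0, 0) :: uc_point" and ?s = "(a, 0, 1, 0) :: uc_point"
  have "{?o, ?s, (b, c, 1, 1)} \<subseteq> ?X"
    using bc(1) a par by (auto simp: mem_feasible_set)
  then have "convex hull {?o, ?s, (b, c, 1, 1)} \<subseteq> convex hull ?X"
    by (rule hull_mono)
  moreover have "(p0, p1, u0, u1) =
      (1 - u0) *\<^sub>R ?o + (u0 - u1) *\<^sub>R ?s + u1 *\<^sub>R (b, c, 1, 1)"
    using a(3) bc(2,3) by (auto simp: algebra_simps)
  then have "(p0, p1, u0, u1) \<in> convex hull {?o, ?s, (b, c, 1, 1)}"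
    unfolding convex_hull_3 mem_Collect_eq
    by (intro exI[of _ "1 - u0"] exI[of _ "u0 - u1"] exI[of _ u1])
      (use u sol in \<open>simp add: mem_solution_set_hull\<close>)
  ultimately show ?thesis by blast
qed

text \<open>Reversing time turns start-ups into shut-downs.\<close>
definition reverse_time :: "uc_point \<Rightarrow> uc_point" where
  "reverse_time = (\<lambda>(p0, p1, u0, u1). (p1, p0, u1, u0))"

lemma reverse_time_feasible_set:
  "reverse_time ` feasible_set Pmin Pmax Rup Rdn Psu Psd =
     feasible_set Pmin Pmax Rdn Rup Psd Psu"
proof -
  have "reverse_time ` feasible_set Pmin Pmax Rup Rdn Psu Psd
      \<subseteq> feasible_set Pmin Pmax Rdn Rup Psd Psu" for Rup Rdn Psu Psd
    by (auto simp: reverse_time_def mem_feasible_set)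
  moreover have "reverse_time (reverse_time z) = z" for z
    by (auto simp: reverse_time_def split: prod.splits)
  ultimately show ?thesis
    by (metis image_eqI image_subset_iff subsetI subset_antisym)
qed

lemma linear_reverse_time: "linear reverse_time"
  by (rule linearI) (auto simp: reverse_time_def)

lemma in_hull:
  assumes sol: "(p0, p1, u0, u1) \<in> solution_set (hull_inequalities Pmin Pmax Rup Rdn Psu Psd)"
    and par: "0 \<le> Pmin" "Pmin \<le> Pmax"
      "Pmin \<le> Psu" "Psu \<le> Pmin + Rup" "Psu \<le> Pmax"
      "Pmin \<le> Psd" "Psd \<le> Pmin + Rdn" "Psd \<le> Pmax"
      "Pmin < Pmax \<or> 0 < Rup \<or> 0 < Rdn"
  shows "(p0, p1, u0, u1) \<in> convex hull (feasible_set Pmin Pmax Rup Rdn Psu Psd)"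
proof -
  note u = commitment_nonneg[OF sol par(2-)]
  show ?thesis
  proof (cases "u1 \<le> u0")
    case True
    then show ?thesis
      using in_hull_if_shutdown[OF sol par(1-8)] u by blast
  next
    case False
    have "(p1, p0, u1, u0) \<in> solution_set (hull_inequalities Pmin Pmax Rdn Rup Psd Psu)"
      using sol by (auto simp: mem_solution_set_hull)
    then have "(p1, p0, u1, u0) \<in> convex hull (feasible_set Pmin Pmax Rdn Rup Psd Psu)"
      using in_hull_if_shutdown par u False by simp
    then have "reverse_time (p1, p0, u1, u0) \<in>
        convex hull (reverse_time ` feasible_set Pmin Pmax Rdn Rup Psd Psu)"
      unfolding convex_hull_linear_image[OF linear_reverse_time, symmetric] by (rule imageI)
    then show ?thesis
      by (simp add: reverse_time_feasible_set) (simp add: reverse_time_def)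
  qed
qed

section \<open>Necessity\<close>

lemma redundant_iff:
  assumes "i < length cs"
  shows "redundant cs i \<longleftrightarrow> (\<forall>x \<in> solution_set (take i cs @ drop (Suc i) cs). (cs ! i) x)"
proof -
  have "set cs = insert (cs ! i) (set (take i cs @ drop (Suc i) cs))"
    using arg_cong[OF id_take_nth_drop[OF assms], of set] by simp
  then have "solution_set cs = solution_set (take i cs @ drop (Suc i) cs) \<inter> {x. (cs ! i) x}"
    unfolding solution_set_def by auto
  then show ?thesis
    unfolding redundant_def by blast
qed

lemma not_redundantI:
  assumes "i < length cs" "\<not> (cs ! i) x" "x \<in> solution_set (take i cs @ drop (Suc i) cs)"
  shows "\<not> redundant cs i"
  using assms redundant_iff by blast

lemma redundant_if_duplicate:
  assumes "i < length cs" "j < length cs" "i \<noteq> j" "cs ! j = cs ! i"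
  shows "redundant cs i"
proof -
  have "cs ! j \<in> set (take i cs @ drop (Suc i) cs)"
  proof (cases "j < i")
    case True
    then have "cs ! j = take i cs ! j" "j < length (take i cs)" using assms by auto
    then show ?thesis by (metis nth_mem UnCI set_append)
  next
    case False
    then have "cs ! j = drop (Suc i) cs ! (j - Suc i)" "j - Suc i < length (drop (Suc i) cs)"
      using assms by auto
    then show ?thesis by (metis nth_mem UnCI set_append)
  qed
  then have "cs ! i \<in> set (take i cs @ drop (Suc i) cs)"
    by (simp only: assms(4))
  then show ?thesis
    unfolding redundant_iff[OF assms(1)] solution_set_def by blast
qed

lemma hull_inequalities_irredundant:
  assumes par: "0 \<le> Pmin"
    "Pmin \<le> Psu" "Psu \<le> Pmin + Rup" "Pmin \<le> Psd" "Psd \<le> Pmin + Rdn"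
    "0 < Rup" "Pmin + Rup < Pmax" "0 < Rdn" "Pmin + Rdn < Pmax"
  defines "L \<equiv> hull_inequalities Pmin Pmax Rup Rdn Psu Psd"
  shows "i \<in> {0, 1, 2, 3, 4, 5, 10, 11} \<Longrightarrow> \<not> redundant L i"
    and "Psu < Pmin + Rup \<Longrightarrow> i \<in> {6, 8} \<Longrightarrow> \<not> redundant L i"
    and "Psd < Pmin + Rdn \<Longrightarrow> i \<in> {7, 9} \<Longrightarrow> \<not> redundant L i"
proof -
  note eval = L_def hull_inequalities_def solution_set_def add_divide_distrib diff_divide_distrib
  \<comment> \<open>At constant commitment the output may drop below \<open>Pmin\<close> by as much as the ramps allow.\<close>
  have 0: "\<not> redundant L 0"
    by (rule not_redundantI[where x = "(Pmin - Rup, Pmin, 1, 1)"];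
      (simp add: eval)?; (intro conjI)?; (use par in linarith))
  have 2: "\<not> redundant L 2"
    by (rule not_redundantI[where x = "(Pmin, Pmin - Rdn, 1, 1)"];
      (simp add: eval)?; (intro conjI)?; (use par in linarith))
  \<comment> \<open>An output of \<open>Pmin\<close> per unit of commitment satisfies, at all nonnegative commitments, every
    inequality other than \<open>u0 \<le> 1\<close> and \<open>u1 \<le> 1\<close>.\<close>
  have 4: "\<not> redundant L 4"
    by (rule not_redundantI[where x = "(2 * Pmin, Pmin, 2, 1)"];
      (simp add: eval)?; (intro conjI)?; (use par in linarith))
  have 5: "\<not> redundant L 5"
    by (rule not_redundantI[where x = "(Pmin, 2 * Pmin, 1, 2)"];
      (simp add: eval)?; (intro conjI)?; (use par in linarith))
  \<comment> \<open>The limits on \<open>p0\<close> by \<open>Pmax\<close> and by shutting down cross at \<open>u0 = u1\<close>, so one is tested at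
    \<open>u0 < u1\<close> and the other at \<open>u1 < u0\<close>; likewise for \<open>p1\<close>. The excess over the violated limit is
    bounded by the gap to the competing one and by the slack in the ramps. Every factor \<open>1 / 2\<close>
    scales a point with commitments \<open>(1, 2)\<close> or \<open>(2, 1)\<close> back below the bounds \<open>u0 \<le> 1\<close>, \<open>u1 \<le> 1\<close>.\<close>
  define r where "r = min Rup (Pmax - Psu)"
  define d where "d = min Rdn (Pmax - Psd)"
  have r: "0 < r" "r \<le> Rup" "r \<le> Pmax - Psu" and d: "0 < d" "d \<le> Rdn" "d \<le> Pmax - Psd"
    using par by (auto simp: r_def d_def)
  have 1: "\<not> redundant L 1"
    by (rule not_redundantI[where x = "((Pmax + d) / 2, (Pmax + Pmin) / 2, 1 / 2, 1)"];
      (simp add: eval)?; (intro conjI)?; (use par d in linarith))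
  have 3: "\<not> redundant L 3"
    by (rule not_redundantI[where x = "((Pmax + Pmin) / 2, (Pmax + r) / 2, 1, 1 / 2)"];
      (simp add: eval)?; (intro conjI)?; (use par r in linarith))
  have 10: "\<not> redundant L 10"
    by (rule not_redundantI[where x = "(Pmax / 2, (Pmax + Psu + r) / 2, 1 / 2, 1)"];
      (simp add: eval)?; (intro conjI)?; (use par r in linarith))
  have 11: "\<not> redundant L 11"
    by (rule not_redundantI[where x = "((Pmax + Psd + d) / 2, Pmax / 2, 1, 1 / 2)"];
      (simp add: eval)?; (intro conjI)?; (use par d in linarith))
  show "i \<in> {0, 1, 2, 3, 4, 5, 10, 11} \<Longrightarrow> \<not> redundant L i"
    using 0 1 2 3 4 5 10 11 by auto
  show "\<not> redundant L i" if "Psu < Pmin + Rup" "i \<in> {6, 8}"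
  proof -
    \<comment> \<open>The first term is the gap to the competing ramping inequality, the second keeps \<open>p1\<close> below
      its capacity limits.\<close>
    define e where "e = min (Pmin + Rup - Psu) (Pmax - Pmin - Rup)"
    have e: "0 < e" "e \<le> Pmin + Rup - Psu" "e \<le> Pmax - Pmin - Rup"
      using par that by (auto simp: e_def)
    have 6: "\<not> redundant L 6"
      by (rule not_redundantI[where x = "(Pmin, (Pmin + Rup + e) / 2, 1, 1 / 2)"];
        (simp add: eval)?; (intro conjI)?; (use par e in linarith))
    have 8: "\<not> redundant L 8"
      by (rule not_redundantI[where x = "(Pmin / 2, (Pmin + Psu + Rup + e) / 2, 1 / 2, 1)"];
        (simp add: eval)?; (intro conjI)?; (use par e in linarith))
    show ?thesis using that 6 8 by auto
  qed
  show "\<not> redundant L i" if "Psd < Pmin + Rdn" "i \<in> {7, 9}"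
  proof -
    define e where "e = min (Pmin + Rdn - Psd) (Pmax - Pmin - Rdn)"
    have e: "0 < e" "e \<le> Pmin + Rdn - Psd" "e \<le> Pmax - Pmin - Rdn"
      using par that by (auto simp: e_def)
    have 7: "\<not> redundant L 7"
      by (rule not_redundantI[where x = "((Pmin + Rdn + e) / 2, Pmin, 1 / 2, 1)"];
        (simp add: eval)?; (intro conjI)?; (use par e in linarith))
    have 9: "\<not> redundant L 9"
      by (rule not_redundantI[where x = "((Pmin + Psd + Rdn + e) / 2, Pmin / 2, 1, 1 / 2)"];
        (simp add: eval)?; (intro conjI)?; (use par e in linarith))
    show ?thesis using that 7 9 by auto
  qed
qed

lemma hull_inequalities_coincide:
  fixes Pmin Pmax Rup Rdn Psu Psd :: real
  defines "L \<equiv> hull_inequalities Pmin Pmax Rup Rdn Psu Psd"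
  shows "Psu = Pmin + Rup \<Longrightarrow> L ! 6 = L ! 8"
    and "Psd = Pmin + Rdn \<Longrightarrow> L ! 7 = L ! 9"
    and "Psu = Pmax \<Longrightarrow> L ! 3 = L ! 10"
  by (simp_all add: L_def hull_inequalities_def)

text \<open>A rise of \<open>p1\<close> over \<open>p0\<close> is at most \<open>Pmax * u1 - Pmin * u0\<close>. The ramping bound exceeds this by
  \<open>(Pmin + Rup - Pmax) * u1\<close>, and \<open>u1\<close> is nonnegative since \<open>Pmin * u1 \<le> p1 \<le> Pmax * u1\<close>.\<close>
lemma ramp_redundant:
  fixes Pmin Pmax Rup Rdn Psu Psd :: real
  assumes "Pmin < Pmax"
  defines "L \<equiv> hull_inequalities Pmin Pmax Rup Rdn Psu Psd"
  shows "Pmax \<le> Pmin + Rup \<Longrightarrow> redundant L 6"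
    and "Pmax \<le> Pmin + Rdn \<Longrightarrow> redundant L 7"
proof -
  have key: "q - p \<le> (Pmin + R) * v - Pmin * u"
    if "Pmax \<le> Pmin + R" "Pmin * u \<le> p" "Pmin * v \<le> q" "q \<le> Pmax * v" for R p q u v :: real
  proof -
    have "0 \<le> (Pmax - Pmin) * v"
      using that by (simp add: algebra_simps)
    then have "0 \<le> v"
      using assms(1) by (simp add: zero_le_mult_iff)
    then have "Pmax * v \<le> (Pmin + R) * v"
      using that(1) by (rule mult_right_mono[rotated])
    then show ?thesis using that by linarith
  qed
  show "redundant L 6" if "Pmax \<le> Pmin + Rup"
    using that by (subst redundant_iff)
      (auto simp: L_def hull_inequalities_def solution_set_def intro: key)
  show "redundant L 7" if "Pmax \<le> Pmin + Rdn"
    using that by (subst redundant_iff)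
      (auto simp: L_def hull_inequalities_def solution_set_def intro: key)
qed

theorem propositionA1:
  fixes Pmin Pmax Rup Rdn Psu Psd :: real
  defines "X \<equiv> feasible_set Pmin Pmax Rup Rdn Psu Psd"
    and "L \<equiv> hull_inequalities Pmin Pmax Rup Rdn Psu Psd"
  assumes "0 \<le> Pmin" and "Pmin \<le> Pmax"
    and "Pmin \<le> Psu" and "Psu \<le> Pmin + Rup" and "Psu \<le> Pmax"
    and "Pmin \<le> Psd" and "Psd \<le> Pmin + Rdn" and "Psd \<le> Pmax"
    and "Pmin < Pmax \<or> 0 < Rup \<or> 0 < Rdn"
  shows "convex hull X = solution_set L \<and>
    ((\<forall>i < length L. \<not> redundant L i) \<longleftrightarrow>
       Psu < Pmin + Rup \<and> Pmin + Rup < Pmax \<and> Psd < Pmin + Rdn \<and> Pmin + Rdn < Pmax) \<and>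
    (0 < Rup \<and> Pmin + Rup < Pmax \<and> 0 < Rdn \<and> Pmin + Rdn < Pmax \<longrightarrow>
       (\<forall>i < length L. redundant L i \<longrightarrow> (\<exists>j < length L. j \<noteq> i \<and> L ! j = L ! i)))"
proof -
  note par = assms(3-)
  have len: "length L = 12"
    by (simp add: L_def hull_inequalities_def)
  have index: "i \<in> {0, 1, 2, 3, 4, 5, 10, 11} \<union> {6, 8} \<union> {7, 9}" if "i < length L" for i
    using that unfolding len Un_iff insert_iff empty_iff by presburger
  have sub: "X \<subseteq> solution_set L"
    unfolding X_def L_def using feasible_set_subset par by simp
  have hull: "convex hull X = solution_set L"
  proof
    show "convex hull X \<subseteq> solution_set L"
      using sub convex_hull_inequalities unfolding L_def by (rule hull_minimal)
    show "solution_set L \<subseteq> convex hull X"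
      using in_hull par unfolding X_def L_def by (auto simp: split_paired_all)
  qed
  note coincide = hull_inequalities_coincide[where Pmin = Pmin and Pmax = Pmax and Rup = Rup
      and Rdn = Rdn and Psu = Psu and Psd = Psd, folded L_def]
  have strict: "Psu < Pmin + Rup \<and> Pmin + Rup < Pmax \<and> Psd < Pmin + Rdn \<and> Pmin + Rdn < Pmax"
    if irr: "\<forall>i < length L. \<not> redundant L i"
  proof -
    have distinct: "L ! j \<noteq> L ! i" if "i < 12" "j < 12" "i \<noteq> j" for i j
      using redundant_if_duplicate[of i L j] irr that unfolding len by blast
    have "Psu \<noteq> Pmax" "Psu \<noteq> Pmin + Rup" "Psd \<noteq> Pmin + Rdn"
      using coincide distinct[of 8 6] distinct[of 9 7] distinct[of 10 3] by force+
    moreover from this have "Pmin < Pmax"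
      using par by linarith
    then have "\<not> Pmax \<le> Pmin + Rup" "\<not> Pmax \<le> Pmin + Rdn"
      using ramp_redundant[where Pmin = Pmin and Pmax = Pmax and Rup = Rup and Rdn = Rdn
          and Psu = Psu and Psd = Psd, folded L_def] irr unfolding len by auto
    ultimately show ?thesis
      using par by linarith
  qed
  have exceptions: "Psu = Pmin + Rup \<and> i \<in> {6, 8} \<or> Psd = Pmin + Rdn \<and> i \<in> {7, 9}"
    if gaps: "0 < Rup" "Pmin + Rup < Pmax" "0 < Rdn" "Pmin + Rdn < Pmax"
      and "i < length L" "redundant L i" for i
  proof -
    note irr = hull_inequalities_irredundant[OF par(1,3,4,6,7) gaps, folded L_def]
    have "i \<notin> {0, 1, 2, 3, 4, 5, 10, 11}" "i \<in> {6, 8} \<Longrightarrow> \<not> Psu < Pmin + Rup"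
        "i \<in> {7, 9} \<Longrightarrow> \<not> Psd < Pmin + Rdn"
      using irr \<open>redundant L i\<close> by blast+
    moreover have "Psu < Pmin + Rup \<or> Psu = Pmin + Rup" "Psd < Pmin + Rdn \<or> Psd = Pmin + Rdn"
      using par by linarith+
    ultimately show ?thesis
      using index[OF \<open>i < length L\<close>] by blast
  qed
  have irredundant: "\<not> redundant L i"
    if "Psu < Pmin + Rup \<and> Pmin + Rup < Pmax \<and> Psd < Pmin + Rdn \<and> Pmin + Rdn < Pmax"
      and "i < length L" for i
  proof -
    have "0 < Rup" "0 < Rdn"
      using that(1) par by linarith+
    then show ?thesis
      using exceptions that by (metis less_irrefl)
  qed
  have duplicate: "\<exists>j < length L. j \<noteq> i \<and> L ! j = L ! i"
    if "0 < Rup \<and> Pmin + Rup < Pmax \<and> 0 < Rdn \<and> Pmin + Rdn < Pmax"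
      and "i < length L" "redundant L i" for i
  proof -
    have "Psu = Pmin + Rup \<and> i \<in> {6, 8} \<or> Psd = Pmin + Rdn \<and> i \<in> {7, 9}"
      using exceptions that by blast
    then consider "L ! 6 = L ! 8" "i = 6" | "L ! 6 = L ! 8" "i = 8"
      | "L ! 7 = L ! 9" "i = 7" | "L ! 7 = L ! 9" "i = 9"
      using coincide(1,2) by blast
    then show ?thesis
    proof cases
      case 1 then show ?thesis by (intro exI[of _ 8]) (simp add: len)
    next
      case 2 then show ?thesis by (intro exI[of _ 6]) (simp add: len)
    next
      case 3 then show ?thesis by (intro exI[of _ 9]) (simp add: len)
    next
      case 4 then show ?thesis by (intro exI[of _ 7]) (simp add: len)
    qed
  qed
  show ?thesis
    using hull strict irredundant duplicate by blast
qed

end
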